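(* The function $T_p:\mathbf P\to\mathbb Z$ belongs to the ring $\Lambda^*$ of shifted symmetric functions for every odd $p\ge1$. Explicitly, the function $\widetilde T_p:\mathbf P\to\mathbb Q$ is the homogeneous element of weight $p+1$ given by $$\frac{\widetilde T_p(\lambda)}{(p-1)!}\;=\;\frac12\sum_{k=0}^{p+1}(-1)^k\,Q_k(\lambda)\,Q_{p+1-k}(\lambda)\qquad(p\ge1).$$
   Context: $\mathbf P$ is the set of all partitions. $T_p(\lambda)=\sum_{\xi\in Y_\lambda}h(\xi)^{p-1}$, where $Y_\lambda$ is the Young diagram of $\lambda$ and $h(\xi)$ is the hook-length of the cell $\xi$. $\widetilde T_p(\lambda)=T_p(\lambda)+\frac12\zeta(-p)$ for $p\ge1$ odd (with $\zeta$ the Riemann zeta function), and $\widetilde T_p(\lambda)=0$ for $p$ even. Define $\beta_k\in\mathbb Q$ by $\frac{z/2}{\sinh(z/2)}=\sum_{k\ge0}\beta_kz^k$, and put $Q_0(\lambda)=1$, $Q_k(\lambda)=\frac{P_{k-1}(\lambda)}{(k-1)!}+\beta_k$ for $k\ge1$, where $P_\ell(\lambda)=\sum_{i\ge1}\bigl[(\lambda_i-i+\tfrac12)^\ell-(-i+\tfrac12)^\ell\bigr]$. $\Lambda^*$ is the algebra of shifted symmetric functions, the projective limit of the algebras of polynomials symmetric in the variables $\lambda_1-1,\dots,\lambda_n-n$ (with transition maps setting the last $\lambda_n$ to $0$); as an algebra of functions on $\mathbf P$ it is freely generated by $P_\ell$, $\ell\ge1$, and it is graded by giving $Q_k$ weight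 $k$. *)

theory Defs
  imports
    "HOL-Complex_Analysis.Complex_Analysis"
    "HOL-Computational_Algebra.Formal_Power_Series"
    "HOL-Combinatorics.Permutations"
begin

typedef nat_partition = "{l :: nat \<Rightarrow> nat. antimono l \<and> finite {i. l i \<noteq> 0}}"
  by (rule exI[of _ "\<lambda>_. 0"]) (simp add: antimono_def)

text \<open>The representing sequences start at index 0, but \<open>part\<close> numbers the parts from 1; its value at 0
  is never used.\<close>

definition part :: "nat_partition \<Rightarrow> nat \<Rightarrow> nat" where
  "part lam i = Rep_nat_partition lam (i - 1)"

definition young_diagram :: "nat_partition \<Rightarrow> (nat \<times> nat) set" where
  "young_diagram lam = {(i, j). 1 \<le> i \<and> 1 \<le> j \<and> j \<le> part lam i}"

definition hook :: "nat_partition \<Rightarrow> nat \<times> nat \<Rightarrow> (nat \<times> nat) set" where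
  "hook lam = (\<lambda>(i, j). {(k, l) \<in> young_diagram lam. (k = i \<and> j \<le> l) \<or> (l = j \<and> i \<le> k)})"

definition hook_length :: "nat_partition \<Rightarrow> nat \<times> nat \<Rightarrow> nat" where
  "hook_length lam c = card (hook lam c)"

text \<open>\<open>T\<^sub>p\<close>; only \<open>p \<ge> 1\<close> is meaningful because of the truncated \<open>p - 1\<close>.\<close>

definition hook_moment :: "nat \<Rightarrow> nat_partition \<Rightarrow> int" where
  "hook_moment p lam = (\<Sum>c\<in>young_diagram lam. int (hook_length lam c) ^ (p - 1))"

text \<open>The holomorphic continuation to the complement of 1 is unique by the identity theorem;
  the value 0 at the pole only serves to make the function total.\<close>

definition riemann_zeta :: "complex \<Rightarrow> complex" where
  "riemann_zeta = (THE f. f holomorphic_on (- {1}) \<and>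
     (\<forall>s. Re s > 1 \<longrightarrow> f s = (\<Sum>n. 1 / of_nat (Suc n) powr s)) \<and> f 1 = 0)"

text \<open>\<open>T\<^sub>p\<close> with its zeta correction. It takes values in \<open>\<complex>\<close> because \<open>riemann_zeta\<close> does.\<close>

definition hook_moment_reg :: "nat \<Rightarrow> nat_partition \<Rightarrow> complex" where
  "hook_moment_reg p lam =
     (if odd p then of_int (hook_moment p lam) + riemann_zeta (- of_nat p) / 2 else 0)"

text \<open>Coefficients of \<open>(z/2) / sinh (z/2)\<close>. The divisor has no constant term, but the
  division of formal power series over a field cancels the common factor \<open>z\<close>.\<close>

definition beta_coeff :: "nat \<Rightarrow> rat" where
  "beta_coeff k = fps_nth
     ((fps_const (1/2) * fps_X) / (fps_const (1/2) * (fps_exp (1/2) - fps_exp (- (1/2))))) k"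

text \<open>The sum over all \<open>i \<ge> 1\<close>, restricted to the finitely many \<open>i\<close> with nonzero \<open>i\<close>-th part,
  outside of which the summand is 0.\<close>

definition P_fun :: "nat \<Rightarrow> nat_partition \<Rightarrow> rat" where
  "P_fun l lam = (\<Sum>i\<in>{i. 1 \<le> i \<and> part lam i \<noteq> 0}.
     (of_nat (part lam i) - of_nat i + 1/2) ^ l - (- of_nat i + 1/2) ^ l)"

definition Q_fun :: "nat \<Rightarrow> nat_partition \<Rightarrow> rat" where
  "Q_fun k lam = (if k = 0 then 1 else P_fun (k - 1) lam / fact (k - 1) + beta_coeff k)"

text \<open>Over the infinite field \<open>\<rat>\<close>, polynomials in \<open>n\<close> variables are the same as polynomial
  functions. These are represented here as functions of sequences \<open>x\<close> that depend on
  \<open>x 1, \<dots>, x n\<close> only.\<close>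

definition poly_fun :: "nat \<Rightarrow> nat \<Rightarrow> ((nat \<Rightarrow> rat) \<Rightarrow> rat) set" where
  "poly_fun n d = {F. \<exists>c. \<forall>x. F x =
     (\<Sum>e\<in>{e :: nat \<Rightarrow> nat. (\<forall>i. i \<notin> {1..n} \<longrightarrow> e i = 0) \<and> (\<Sum>i=1..n. e i) \<le> d}.
        c e * (\<Prod>i=1..n. x i ^ e i))}"

definition sym_poly_fun :: "nat \<Rightarrow> nat \<Rightarrow> ((nat \<Rightarrow> rat) \<Rightarrow> rat) set" where
  "sym_poly_fun n d = {F \<in> poly_fun n d. \<forall>\<pi> x. \<pi> permutes {1..n} \<longrightarrow> F (x \<circ> \<pi>) = F x}"

definition shifted_sym_poly_fun :: "nat \<Rightarrow> nat \<Rightarrow> ((nat \<Rightarrow> rat) \<Rightarrow> rat) set" where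
  "shifted_sym_poly_fun n d = {\<lambda>x. G (\<lambda>i. x i - of_nat i) | G. G \<in> sym_poly_fun n d}"

text \<open>The projective limit, as an algebra of functions on partitions: an element is a compatible
  family \<open>F\<close>, evaluated at a partition with at most \<open>n\<close> parts by means of \<open>F n\<close>. The limit is
  taken in filtered algebras, i.e. the degrees in a family are bounded; without the bound it
  would not be generated by the \<open>P\<^sub>l\<close>.\<close>

definition shifted_symmetric :: "(nat_partition \<Rightarrow> rat) set" where
  "shifted_symmetric = {f. \<exists>d F.
     (\<forall>n. F n \<in> shifted_sym_poly_fun n d) \<and>
     (\<forall>n x. F (Suc n) (x(Suc n := 0)) = F n x) \<and>
     (\<forall>n lam. part lam (Suc n) = 0 \<longrightarrow> f lam = F n (\<lambda>i. of_nat (part lam i)))}"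

text \<open>The homogeneous elements of weight \<open>w\<close>: rational linear combinations of the monomials in
  the \<open>Q\<^sub>k\<close> of total weight \<open>w\<close>.\<close>

definition homogeneous_weight :: "nat \<Rightarrow> (nat_partition \<Rightarrow> rat) set" where
  "homogeneous_weight w = {f \<in> shifted_symmetric. \<exists>(S :: nat list set) c.
     finite S \<and> (\<forall>ks\<in>S. sum_list ks = w) \<and>
     (\<forall>lam. f lam = (\<Sum>ks\<in>S. c ks * (\<Prod>k\<leftarrow>ks. Q_fun k lam)))}"

end

theory Submission
  imports Defs
begin

text \<open>
  Let \<open>W(z) = \<Sum> Q\<^sub>k z\<^sup>k\<close>; the right-hand side of the formula is half a coefficient of \<open>W(z) W(-z)\<close>.
  With \<open>m\<^sub>i = \<lambda>\<^sub>i + n - i\<close>, this product involves the double sum of \<open>exp((m\<^sub>i - m\<^sub>k) z)\<close>. The hook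
  lengths of row \<open>i\<close> together with the differences \<open>m\<^sub>i - m\<^sub>k\<close>, \<open>k > i\<close>, fill up \<open>{1..m\<^sub>i}\<close>;
  hence \<open>W(z) W(-z) = 2 z\<^sup>2 \<Sum> cosh (h z) + ((z/2) / sinh (z/2))\<^sup>2\<close>, the sum being over all hook
  lengths \<open>h\<close>. The coefficients of the last square are values of \<open>\<zeta>\<close> at negative integers: a
  recurrence expressing \<open>w(s) = (s - 1) \<zeta>(s)\<close> by \<open>w(s + 2), w(s + 4), \<dots>\<close> gives both the
  continuation of \<open>\<zeta>\<close> and the generating function of its values.
\<close>

section \<open>Shifted symmetric functions\<close>

definition bounded_exponents :: "nat \<Rightarrow> nat \<Rightarrow> (nat \<Rightarrow> nat) set" where
  "bounded_exponents n d = {e. (\<forall>i. i \<notin> {1..n} \<longrightarrow> e i = 0) \<and> (\<Sum>i=1..n. e i) \<le> d}"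

lemma poly_fun_altdef:
  "F \<in> poly_fun n d \<longleftrightarrow> (\<exists>c. \<forall>x. F x = (\<Sum>e\<in>bounded_exponents n d. c e * (\<Prod>i=1..n. x i ^ e i)))"
  by (simp add: poly_fun_def bounded_exponents_def)

lemma finite_bounded_exponents: "finite (bounded_exponents n d)"
proof (rule finite_subset)
  show "bounded_exponents n d \<subseteq> {e. \<forall>i. (i \<in> {1..n} \<longrightarrow> e i \<in> {..d}) \<and> (i \<notin> {1..n} \<longrightarrow> e i = 0)}"
  proof (intro subsetI CollectI allI conjI impI)
    fix e i assume e: "e \<in> bounded_exponents n d" and i: "i \<in> {1..n}"
    have "e i \<le> (\<Sum>i=1..n. e i)"
      using i by (intro member_le_sum) auto
    also have "\<dots> \<le> d" using e by (simp add: bounded_exponents_def)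
    finally show "e i \<in> {..d}" by simp
  qed (auto simp: bounded_exponents_def)
  show "finite {e. \<forall>i. (i \<in> {1..n} \<longrightarrow> e i \<in> {..d}) \<and> (i \<notin> {1..n} \<longrightarrow> e i = (0::nat))}"
    by (intro finite_set_of_finite_funs) auto
qed

lemma poly_fun_monom: "e \<in> bounded_exponents n d \<Longrightarrow> (\<lambda>x. \<Prod>i=1..n. x i ^ e i) \<in> poly_fun n d"
  unfolding poly_fun_altdef
  by (intro exI[of _ "\<lambda>e'. if e' = e then 1 else 0"]) (simp add: finite_bounded_exponents if_distrib[of "\<lambda>c. c * _"] cong: if_cong)

lemma poly_fun_add: "F \<in> poly_fun n d \<Longrightarrow> G \<in> poly_fun n d \<Longrightarrow> (\<lambda>x. F x + G x) \<in> poly_fun n d"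
  unfolding poly_fun_altdef
  apply clarify
  subgoal for c c' by (intro exI[of _ "\<lambda>e. c e + c' e"]) (simp add: algebra_simps sum.distrib)
  done

lemma poly_fun_cmult: "F \<in> poly_fun n d \<Longrightarrow> (\<lambda>x. a * F x) \<in> poly_fun n d"
  unfolding poly_fun_altdef
  apply clarify
  subgoal for c by (intro exI[of _ "\<lambda>e. a * c e"]) (simp add: algebra_simps sum_distrib_left)
  done

lemma poly_fun_zero: "(\<lambda>x. 0) \<in> poly_fun n d"
  unfolding poly_fun_altdef by (intro exI[of _ "\<lambda>e. 0"]) simp

lemma poly_fun_sum:
  "(\<And>a. a \<in> A \<Longrightarrow> F a \<in> poly_fun n d) \<Longrightarrow> (\<lambda>x. \<Sum>a\<in>A. F a x) \<in> poly_fun n d"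
  by (induction A rule: infinite_finite_induct) (auto intro: poly_fun_zero poly_fun_add)

lemma poly_fun_mult:
  assumes "F \<in> poly_fun n d" "G \<in> poly_fun n d'"
  shows "(\<lambda>x. F x * G x) \<in> poly_fun n (d + d')"
proof -
  obtain c c' where F: "\<And>x. F x = (\<Sum>e\<in>bounded_exponents n d. c e * (\<Prod>i=1..n. x i ^ e i))"
    and G: "\<And>x. G x = (\<Sum>e\<in>bounded_exponents n d'. c' e * (\<Prod>i=1..n. x i ^ e i))"
    using assms unfolding poly_fun_altdef by blast
  have "(\<lambda>x. F x * G x) = (\<lambda>x. \<Sum>e\<in>bounded_exponents n d. \<Sum>e'\<in>bounded_exponents n d'.
          (c e * c' e') * (\<Prod>i=1..n. x i ^ (e i + e' i)))"
    unfolding F G sum_product power_add prod.distrib by (simp only: mult_ac)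
  also have "\<dots> \<in> poly_fun n (d + d')"
    by (intro poly_fun_sum poly_fun_cmult poly_fun_monom) (auto simp: bounded_exponents_def sum.distrib)
  finally show ?thesis .
qed

lemma poly_fun_const: "(\<lambda>x. a) \<in> poly_fun n d"
  using poly_fun_cmult[OF poly_fun_monom[of "\<lambda>_. 0" n d], of a] by (simp add: bounded_exponents_def)

lemma poly_fun_mono: 
  assumes "F \<in> poly_fun n d" "d \<le> d'"
  shows "F \<in> poly_fun n d'"
  using poly_fun_mult[OF assms(1) poly_fun_const[of 1 n "d' - d"]] assms(2) by simp

lemma poly_fun_var:
  assumes "i \<in> {1..n}"
  shows "(\<lambda>x. x i) \<in> poly_fun n 1"
proof -
  have "(\<lambda>j. if j = i then 1 else 0) \<in> bounded_exponents n 1"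
    using assms by (auto simp: bounded_exponents_def)
  from poly_fun_monom[OF this] show ?thesis
    using assms by (simp add: if_distrib[of "power _"] cong: if_cong)
qed

lemma poly_fun_power:
  "F \<in> poly_fun n d \<Longrightarrow> (\<lambda>x. F x ^ k) \<in> poly_fun n (k * d)"
  by (induction k) (auto intro: poly_fun_const poly_fun_mult)

definition shifted_rep :: "nat \<Rightarrow> (nat \<Rightarrow> (nat \<Rightarrow> rat) \<Rightarrow> rat) \<Rightarrow> (nat_partition \<Rightarrow> rat) \<Rightarrow> bool" where
  "shifted_rep d G f \<longleftrightarrow>
     (\<forall>n. G n \<in> poly_fun n d) \<and>
     (\<forall>n \<pi> x. \<pi> permutes {1..n} \<longrightarrow> G n (x \<circ> \<pi>) = G n x) \<and>
     (\<forall>n x. G (Suc n) (\<lambda>i. (x(Suc n := 0)) i - of_nat i) = G n (\<lambda>i. x i - of_nat i)) \<and>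
     (\<forall>n lam. part lam (Suc n) = 0 \<longrightarrow> f lam = G n (\<lambda>i. of_nat (part lam i) - of_nat i))"

lemma shifted_repD:
  assumes "shifted_rep d G f"
  shows "G n \<in> poly_fun n d"
    and "\<pi> permutes {1..n} \<Longrightarrow> G n (x \<circ> \<pi>) = G n x"
    and "G (Suc n) (\<lambda>i. (x(Suc n := 0)) i - of_nat i) = G n (\<lambda>i. x i - of_nat i)"
    and "part lam (Suc n) = 0 \<Longrightarrow> f lam = G n (\<lambda>i. of_nat (part lam i) - of_nat i)"
  using assms unfolding shifted_rep_def by blast+

lemma shifted_symmetric_altdef: "f \<in> shifted_symmetric \<longleftrightarrow> (\<exists>d G. shifted_rep d G f)"
proof
  assume "f \<in> shifted_symmetric"
  then obtain d F where F: "\<And>n. F n \<in> shifted_sym_poly_fun n d"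
     "\<And>n x. F (Suc n) (x(Suc n := 0)) = F n x"
     "\<And>n lam. part lam (Suc n) = 0 \<Longrightarrow> f lam = F n (\<lambda>i. of_nat (part lam i))"
    unfolding shifted_symmetric_def by blast
  have "\<forall>n. \<exists>G. G \<in> sym_poly_fun n d \<and> F n = (\<lambda>x. G (\<lambda>i. x i - of_nat i))"
    using F(1) unfolding shifted_sym_poly_fun_def by blast
  then obtain G where G: "\<And>n. G n \<in> sym_poly_fun n d" "\<And>n. F n = (\<lambda>x. G n (\<lambda>i. x i - of_nat i))"
    by metis
  have "shifted_rep d G f"
    unfolding shifted_rep_def
  proof (intro conjI allI impI)
    show "G n \<in> poly_fun n d" for n
      using G(1)[of n] by (simp add: sym_poly_fun_def)
    show "G n (x \<circ> \<pi>) = G n x" if "\<pi> permutes {1..n}" for n \<pi> x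
      using G(1)[of n] that by (simp add: sym_poly_fun_def)
  qed (use F(2,3) in \<open>unfold G(2), blast+\<close>)
  then show "\<exists>d G. shifted_rep d G f" by blast
next
  assume "\<exists>d G. shifted_rep d G f"
  then obtain d G where G: "shifted_rep d G f" by blast
  have "(\<lambda>x. G n (\<lambda>i. x i - of_nat i)) \<in> shifted_sym_poly_fun n d" for n
    using G unfolding shifted_sym_poly_fun_def sym_poly_fun_def shifted_rep_def by blast
  then show "f \<in> shifted_symmetric"
    unfolding shifted_symmetric_def mem_Collect_eq using G unfolding shifted_rep_def
    by (intro exI[of _ d] exI[of _ "\<lambda>n x. G n (\<lambda>i. x i - of_nat i)"]) blast
qed

lemma shifted_symmetric_const: "(\<lambda>_. a) \<in> shifted_symmetric"
  unfolding shifted_symmetric_altdef shifted_rep_def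
  by (rule exI[of _ 0], rule exI[of _ "\<lambda>_ _. a"]) (simp add: poly_fun_const)

lemma shifted_symmetric_add:
  assumes "f \<in> shifted_symmetric" "g \<in> shifted_symmetric"
  shows "(\<lambda>lam. f lam + g lam) \<in> shifted_symmetric"
proof -
  obtain d F where F: "shifted_rep d F f"
    using assms(1) shifted_symmetric_altdef by blast
  obtain d' G where G: "shifted_rep d' G g"
    using assms(2) shifted_symmetric_altdef by blast
  have "shifted_rep (max d d') (\<lambda>n x. F n x + G n x) (\<lambda>lam. f lam + g lam)"
    unfolding shifted_rep_def
  proof (intro conjI allI impI)
    show "(\<lambda>x. F n x + G n x) \<in> poly_fun n (max d d')" for n
      by (intro poly_fun_add poly_fun_mono[OF shifted_repD(1)[OF F]] poly_fun_mono[OF shifted_repD(1)[OF G]]) auto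
    show "F n (x \<circ> \<pi>) + G n (x \<circ> \<pi>) = F n x + G n x" if "\<pi> permutes {1..n}" for n \<pi> x
      by (simp only: shifted_repD(2)[OF F that] shifted_repD(2)[OF G that])
    show "F (Suc n) (\<lambda>i. (x(Suc n := 0)) i - of_nat i) + G (Suc n) (\<lambda>i. (x(Suc n := 0)) i - of_nat i) =
        F n (\<lambda>i. x i - of_nat i) + G n (\<lambda>i. x i - of_nat i)" for n x
      by (simp only: shifted_repD(3)[OF F] shifted_repD(3)[OF G])
    show "f lam + g lam = F n (\<lambda>i. of_nat (part lam i) - of_nat i) +
        G n (\<lambda>i. of_nat (part lam i) - of_nat i)" if "part lam (Suc n) = 0" for n lam
      by (simp only: shifted_repD(4)[OF F that] shifted_repD(4)[OF G that])
  qed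
  then show ?thesis unfolding shifted_symmetric_altdef by blast
qed

lemma shifted_symmetric_mult:
  assumes "f \<in> shifted_symmetric" "g \<in> shifted_symmetric"
  shows "(\<lambda>lam. f lam * g lam) \<in> shifted_symmetric"
proof -
  obtain d F where F: "shifted_rep d F f"
    using assms(1) shifted_symmetric_altdef by blast
  obtain d' G where G: "shifted_rep d' G g"
    using assms(2) shifted_symmetric_altdef by blast
  have "shifted_rep (d + d') (\<lambda>n x. F n x * G n x) (\<lambda>lam. f lam * g lam)"
    unfolding shifted_rep_def
  proof (intro conjI allI impI)
    show "(\<lambda>x. F n x * G n x) \<in> poly_fun n (d + d')" for n
      by (intro poly_fun_mult shifted_repD(1)[OF F] shifted_repD(1)[OF G])
    show "F n (x \<circ> \<pi>) * G n (x \<circ> \<pi>) = F n x * G n x" if "\<pi> permutes {1..n}" for n \<pi> x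
      by (simp only: shifted_repD(2)[OF F that] shifted_repD(2)[OF G that])
    show "F (Suc n) (\<lambda>i. (x(Suc n := 0)) i - of_nat i) * G (Suc n) (\<lambda>i. (x(Suc n := 0)) i - of_nat i) =
        F n (\<lambda>i. x i - of_nat i) * G n (\<lambda>i. x i - of_nat i)" for n x
      by (simp only: shifted_repD(3)[OF F] shifted_repD(3)[OF G])
    show "f lam * g lam = F n (\<lambda>i. of_nat (part lam i) - of_nat i) *
        G n (\<lambda>i. of_nat (part lam i) - of_nat i)" if "part lam (Suc n) = 0" for n lam
      by (simp only: shifted_repD(4)[OF F that] shifted_repD(4)[OF G that])
  qed
  then show ?thesis unfolding shifted_symmetric_altdef by blast
qed

lemma shifted_symmetric_sum:
  "(\<And>a. a \<in> A \<Longrightarrow> f a \<in> shifted_symmetric) \<Longrightarrow> (\<lambda>lam. \<Sum>a\<in>A. f a lam) \<in> shifted_symmetric"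
  by (induction A rule: infinite_finite_induct)
     (auto intro: shifted_symmetric_const shifted_symmetric_add)

lemma part_antimono: "1 \<le> i \<Longrightarrow> i \<le> j \<Longrightarrow> part lam j \<le> part lam i"
  unfolding part_def using Rep_nat_partition[of lam] by (auto dest: antimonoD[of _ "i - 1" "j - 1"])

lemma part_eventually_0: "\<exists>n. part lam (Suc n) = 0"
proof -
  have "finite {i. Rep_nat_partition lam i \<noteq> 0}" 
    using Rep_nat_partition[of lam] by auto
  then obtain n where "n \<notin> {i. Rep_nat_partition lam i \<noteq> 0}" 
    using ex_new_if_finite infinite_UNIV_nat by blast
  then show ?thesis by (auto simp: part_def)
qed

lemma P_fun_eq_sum:
  assumes "part lam (Suc n) = 0"
  shows "P_fun l lam = (\<Sum>i=1..n. (of_nat (part lam i) - of_nat i + 1/2) ^ l - (- of_nat i + 1/2) ^ l)"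
  unfolding P_fun_def
proof (rule sum.mono_neutral_left)
  show "{i. 1 \<le> i \<and> part lam i \<noteq> 0} \<subseteq> {1..n}"
    using part_antimono[of "Suc n" _ lam] assms by (force simp: not_less_eq_eq)
qed auto

lemma shifted_symmetric_P_fun: "P_fun l \<in> shifted_symmetric"
proof -
  define G where
    "G = (\<lambda>n (y :: nat \<Rightarrow> rat). \<Sum>i=1..n. (y i + 1/2) ^ l + (-1) * (- of_nat i + 1/2) ^ l)"
  have "shifted_rep l G (P_fun l)"
    unfolding shifted_rep_def
  proof (intro conjI allI impI)
    fix n
    have "(\<lambda>y. (y i + 1/2) ^ l) \<in> poly_fun n l" if "i \<in> {1..n}" for i
      using poly_fun_power[OF poly_fun_add[OF poly_fun_var[OF that] poly_fun_const], of "1/2" l] by simp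
    then show "G n \<in> poly_fun n l"
      unfolding G_def by (intro poly_fun_sum poly_fun_add poly_fun_const)
  next
    fix n and \<pi> :: "nat \<Rightarrow> nat" and x :: "nat \<Rightarrow> rat" assume \<pi>: "\<pi> permutes {1..n}"
    have "(\<Sum>i=1..n. (x (\<pi> i) + 1/2) ^ l) = (\<Sum>i=1..n. (x i + 1/2) ^ l)"
      using sum.permute[OF \<pi>, of "\<lambda>i. (x i + 1/2) ^ l"] by (simp add: o_def)
    then show "G n (x \<circ> \<pi>) = G n x"
      by (simp add: G_def sum.distrib sum_subtractf)
  next
    fix n and x :: "nat \<Rightarrow> rat"
    have "(\<Sum>i=1..n. ((x(Suc n := 0)) i - of_nat i + 1/2) ^ l) = (\<Sum>i=1..n. (x i - of_nat i + 1/2) ^ l)"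
      by (intro sum.cong) auto
    then show "G (Suc n) (\<lambda>i. (x(Suc n := 0)) i - of_nat i) = G n (\<lambda>i. x i - of_nat i)"
      by (simp add: G_def sum.distrib sum_subtractf)
  next
    fix n lam assume "part lam (Suc n) = 0"
    then show "P_fun l lam = G n (\<lambda>i. of_nat (part lam i) - of_nat i)"
      by (simp add: G_def P_fun_eq_sum)
  qed
  then show ?thesis unfolding shifted_symmetric_altdef by blast
qed

lemma shifted_symmetric_Q_fun: "Q_fun k \<in> shifted_symmetric"
proof (cases "k = 0")
  case True
  then have "Q_fun k = (\<lambda>_. 1)" by (simp add: Q_fun_def fun_eq_iff)
  then show ?thesis by (simp add: shifted_symmetric_const)
next
  case False
  then have "Q_fun k = (\<lambda>lam. (1 / fact (k-1)) * P_fun (k-1) lam + beta_coeff k)" 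
    by (simp add: Q_fun_def fun_eq_iff)
  also have "\<dots> \<in> shifted_symmetric"
    by (intro shifted_symmetric_add shifted_symmetric_mult shifted_symmetric_const shifted_symmetric_P_fun)
  finally show ?thesis .
qed

section \<open>Hook lengths and the generating series of the Q-functions\<close>

definition part_conj :: "nat_partition \<Rightarrow> nat \<Rightarrow> nat" where
  "part_conj lam j = card {k. 1 \<le> k \<and> j \<le> part lam k}"

lemma le_part_conj_iff:
  assumes "1 \<le> j" "1 \<le> k"
  shows "k \<le> part_conj lam j \<longleftrightarrow> j \<le> part lam k"
proof -
  define A where "A = {k. 1 \<le> k \<and> j \<le> part lam k}"
  obtain n where n: "part lam (Suc n) = 0" using part_eventually_0 by blast
  have "A \<subseteq> {1..n}"
    using part_antimono[of "Suc n" _ lam] n assms unfolding A_def by (force simp: not_less_eq_eq)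
  then have fin: "finite A" by (rule finite_subset) simp
  show ?thesis
  proof
    assume "j \<le> part lam k"
    then have "{1..k} \<subseteq> A"
      using part_antimono[of _ k lam] le_trans unfolding A_def by fastforce
    from card_mono[OF fin this] show "k \<le> part_conj lam j" by (simp add: part_conj_def A_def)
  next
    assume k: "k \<le> part_conj lam j"
    show "j \<le> part lam k"
    proof (rule ccontr)
      assume "\<not> j \<le> part lam k"
      moreover have "j \<le> part lam k" if "x \<in> A" "k \<le> x" for x
        using part_antimono[OF \<open>1 \<le> k\<close> that(2), of lam] that(1) by (simp add: A_def)
      ultimately have "A \<subseteq> {1..<k}"
        by (force simp: A_def not_less)
      from card_mono[OF _ this] k assms show False by (simp add: part_conj_def A_def)
    qed
  qed
qed

lemma hook_length_eq:
  assumes "1 \<le> i" "1 \<le> j" "j \<le> part lam i"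
  shows "hook_length lam (i, j) = (part lam i - j + 1) + (part_conj lam j - i)"
proof -
  have "hook lam (i, j) = {i} \<times> {j..part lam i} \<union> {Suc i..part_conj lam j} \<times> {j}"
    using assms le_part_conj_iff[OF \<open>1 \<le> j\<close>, of _ lam]
    by (auto simp: hook_def young_diagram_def le_Suc_eq Suc_le_eq)
  moreover have "card \<dots> = card ({i} \<times> {j..part lam i}) + card ({Suc i..part_conj lam j} \<times> {j})"
    by (rule card_Un_disjoint) auto
  ultimately show ?thesis
    using assms by (simp add: hook_length_def card_cartesian_product)
qed

text \<open>The hook lengths in row \<open>i\<close> are exactly the numbers in \<open>{1..m i}\<close> that are not of the form
  \<open>m i - m k\<close> with \<open>k > i\<close>, where \<open>m i = part lam i + n - i\<close>.\<close>

lemma sum_row_hook_length: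
  fixes f :: "nat \<Rightarrow> 'a :: comm_monoid_add"
  defines "m \<equiv> \<lambda>lam n i. part lam i + n - i"
  assumes n: "part lam (Suc n) = 0" and i: "1 \<le> i" "i \<le> n"
  shows "(\<Sum>j=1..part lam i. f (hook_length lam (i, j))) + (\<Sum>k=Suc i..n. f (m lam n i - m lam n k))
           = (\<Sum>t=1..m lam n i. f t)"
proof -
  define h where "h = (\<lambda>j. hook_length lam (i, j))"
  define d where "d = (\<lambda>k. m lam n i - m lam n k)"
  have conj_ge: "i \<le> part_conj lam j" if "j \<in> {1..part lam i}" for j
    using le_part_conj_iff[of j i lam] that i by auto
  have conj_le: "part_conj lam j \<le> n" if "1 \<le> j" for j
    using le_part_conj_iff[of j "Suc n" lam] that n by simp
  have h_eq: "h j = (part lam i - j + 1) + (part_conj lam j - i)" if "j \<in> {1..part lam i}" for j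
    using hook_length_eq[of i j lam] that i by (simp add: h_def)
  have h_less: "h j' < h j" if "j \<in> {1..part lam i}" "j' \<in> {1..part lam i}" "j < j'" for j j'
    using le_part_conj_iff[of j "part_conj lam j'" lam] le_part_conj_iff[of j' "part_conj lam j'" lam]
      conj_ge[of j'] conj_ge[of j] that i h_eq[of j] h_eq[of j'] by auto
  have inj_h: "inj_on h {1..part lam i}"
    by (rule linorder_inj_onI) (use h_less in \<open>fastforce+\<close>)
  have m_less: "m lam n l < m lam n k" if "1 \<le> k" "k < l" "l \<le> n" for k l
    using part_antimono[of k l lam] that by (auto simp: m_def)
  have inj_d: "inj_on d {Suc i..n}"
  proof (rule linorder_inj_onI)
    fix k l assume "k < l" "k \<in> {Suc i..n}" "l \<in> {Suc i..n}"
    then show "d k \<noteq> d l"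
      using m_less[of k l] m_less[of i k] m_less[of i l] i by (auto simp: d_def)
  qed auto
  have disj: "h ` {1..part lam i} \<inter> d ` {Suc i..n} = {}"
  proof -
    have "h j \<noteq> d k" if j: "j \<in> {1..part lam i}" and k: "k \<in> {Suc i..n}" for j k
      using le_part_conj_iff[of j k lam] h_eq[OF j] conj_ge[OF j] conj_le[of j] j k i m_less[of i k]
      by (cases "k \<le> part_conj lam j") (auto simp: d_def m_def)
    then show ?thesis by auto
  qed
  have "h ` {1..part lam i} \<union> d ` {Suc i..n} = {1..m lam n i}"
  proof (rule card_subset_eq)
    have "h j \<in> {1..m lam n i}" if j: "j \<in> {1..part lam i}" for j
      using h_eq[OF j] conj_ge[OF j] conj_le[of j] j i by (auto simp: m_def)
    moreover have "d k \<in> {1..m lam n i}" if "k \<in> {Suc i..n}" for k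
      using m_less[of i k] that i by (auto simp: d_def)
    ultimately show "h ` {1..part lam i} \<union> d ` {Suc i..n} \<subseteq> {1..m lam n i}" by blast
    show "card (h ` {1..part lam i} \<union> d ` {Suc i..n}) = card {1..m lam n i}"
      using i card_image[OF inj_h] card_image[OF inj_d] card_Un_disjoint[OF _ _ disj]
      by (simp add: m_def)
  qed simp
  then have "(\<Sum>t=1..m lam n i. f t) = sum f (h ` {1..part lam i}) + sum f (d ` {Suc i..n})"
    using disj by (metis finite_atLeastAtMost finite_imageI sum.union_disjoint)
  also have "\<dots> = (\<Sum>j=1..part lam i. f (h j)) + (\<Sum>k=Suc i..n. f (d k))"
    using sum.reindex[OF inj_h, of f] sum.reindex[OF inj_d, of f] by simp
  finally show ?thesis by (simp add: h_def d_def)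
qed

lemma young_diagram_eq:
  assumes "part lam (Suc n) = 0"
  shows "young_diagram lam = (SIGMA i:{1..n}. {1..part lam i})"
  using part_antimono[of "Suc n" _ lam] assms
  unfolding young_diagram_def by (force simp: not_less_eq_eq)

lemma sum_square_eq_diagonal_plus:
  fixes g :: "nat \<Rightarrow> nat \<Rightarrow> 'a :: comm_monoid_add"
  shows "(\<Sum>i=1..n. \<Sum>k=1..n. g i k) = (\<Sum>i=1..n. g i i) + (\<Sum>i=1..n. \<Sum>k=Suc i..n. g i k + g k i)"
proof (induction n)
  case (Suc n)
  have "(\<Sum>i=1..n. \<Sum>k=Suc i..Suc n. g i k + g k i) =
        (\<Sum>i=1..n. (\<Sum>k=Suc i..n. g i k + g k i) + (g i (Suc n) + g (Suc n) i))"
    by (intro sum.cong) auto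
  then show ?case using Suc by (simp add: sum.distrib ac_simps)
qed simp

abbreviation two_sinh :: "rat fps" where
  "two_sinh \<equiv> fps_exp (1/2) - fps_exp (- (1/2))"

definition beta_fps :: "rat fps" where
  "beta_fps = Abs_fps beta_coeff"

lemma two_sinh_nz: "two_sinh \<noteq> 0"
proof
  assume "two_sinh = 0"
  then have "fps_nth two_sinh 1 = 0" by simp
  then show False by simp
qed

lemma beta_fps_mult_two_sinh: "beta_fps * two_sinh = fps_X"
proof -
  have beta_fps: "beta_fps = (fps_const (1/2) * fps_X) / (fps_const (1/2) * two_sinh)"
    unfolding beta_fps_def beta_coeff_def by (rule fps_ext) (simp only: fps_nth_Abs_fps)
  have "subdegree (fps_const (1/2) * two_sinh) = 1"
    by (rule subdegreeI) auto
  then have "fps_const (1/2) * two_sinh dvd fps_const (1/2) * fps_X"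
    using two_sinh_nz by (subst fps_dvd_iff) (auto)
  from dvd_div_mult_self[OF this]
  have "fps_const (1/2) * (beta_fps * two_sinh) = fps_const (1/2) * fps_X"
    unfolding beta_fps by (simp only: mult_ac)
  then show ?thesis by simp
qed

lemma fps_exp_compose_uminus: "fps_exp (c :: 'a :: field_char_0) oo (- fps_X) = fps_exp (- c)"
  by (simp add: fps_eq_iff fps_compose_uminus' power_minus[of c])

lemma beta_fps_even: "beta_fps oo (- fps_X) = beta_fps"
proof -
  have "(beta_fps oo (- fps_X)) * (two_sinh oo (- fps_X)) = fps_X oo (- fps_X)"
    by (subst fps_compose_mult_distrib [symmetric]) (simp_all only: beta_fps_mult_two_sinh, simp)
  moreover have "two_sinh oo (- fps_X) = - two_sinh"
    by (simp add: fps_compose_sub_distrib fps_exp_compose_uminus)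
  moreover have "fps_X oo (- fps_X) = - (fps_X :: rat fps)" by simp
  ultimately have "(beta_fps oo (- fps_X)) * two_sinh = beta_fps * two_sinh"
    unfolding beta_fps_mult_two_sinh by (metis minus_equation_iff mult_minus_right)
  then show ?thesis using two_sinh_nz by (metis mult_right_cancel)
qed

lemma beta_coeff_0: "beta_coeff 0 = 1"
  using arg_cong[OF beta_fps_mult_two_sinh, of "\<lambda>f. fps_nth f 1"]
  by (simp add: fps_mult_nth beta_fps_def)

lemma two_sinh_mult_geometric:
  "two_sinh * (\<Sum>i=1..n. fps_exp (- of_nat i + 1/2)) = 1 - fps_exp (- of_nat n)"
  by (induction n) (auto simp: algebra_simps simp flip: fps_exp_add_mult)

lemma Q_fun_fps:
  assumes n: "part lam (Suc n) = 0"
  shows "Abs_fps (\<lambda>k. Q_fun k lam) =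
    fps_X * (\<Sum>i=1..n. fps_exp (of_nat (part lam i) - of_nat i + 1/2)) + beta_fps * fps_exp (- of_nat n)"
proof -
  have "Abs_fps (\<lambda>k. Q_fun k lam) = fps_X * (\<Sum>i=1..n. fps_exp (of_nat (part lam i) - of_nat i + 1/2)
     - fps_exp (- of_nat i + 1/2)) + beta_fps"
  proof (rule fps_ext)
    fix k
    show "fps_nth (Abs_fps (\<lambda>k. Q_fun k lam)) k = fps_nth (fps_X * (\<Sum>i=1..n.
       fps_exp (of_nat (part lam i) - of_nat i + 1/2) - fps_exp (- of_nat i + 1/2)) + beta_fps) k"
      by (cases k) (simp_all add: Q_fun_def beta_fps_def beta_coeff_0 P_fun_eq_sum[OF n]
            fps_sum_nth sum_subtractf diff_divide_distrib sum_divide_distrib)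
  qed
  also have "\<dots> = fps_X * (\<Sum>i=1..n. fps_exp (of_nat (part lam i) - of_nat i + 1/2)) -
      beta_fps * (two_sinh * (\<Sum>i=1..n. fps_exp (- of_nat i + 1/2))) + beta_fps"
    unfolding mult.assoc [symmetric] beta_fps_mult_two_sinh by (simp only: sum_subtractf right_diff_distrib)
  finally show ?thesis
    unfolding two_sinh_mult_geometric by (simp add: algebra_simps)
qed

lemma two_sinh_mult_dirichlet_kernel:
  "two_sinh * (1 + (\<Sum>t=1..m. fps_exp (of_nat t) + fps_exp (- of_nat t))) =
     fps_exp (of_nat m + 1/2) - fps_exp (- (of_nat m + 1/2))"
proof (induction m)
  case (Suc m)
  have eq: "fps_exp a * fps_exp b = fps_exp c" if "a + b = c" for a b c :: rat
    using that by (simp flip: fps_exp_add_mult)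
  have "two_sinh * (fps_exp (of_nat (Suc m)) + fps_exp (- of_nat (Suc m))) =
      (fps_exp (of_nat (Suc m) + 1/2) - fps_exp (- (of_nat (Suc m) + 1/2))) -
      (fps_exp (of_nat m + 1/2) - fps_exp (- (of_nat m + 1/2)))"
    using eq[of "1/2" "of_nat (Suc m)" "of_nat (Suc m) + 1/2"]
      eq[of "1/2" "- of_nat (Suc m)" "- (of_nat m + 1/2)"]
      eq[of "- (1/2)" "of_nat (Suc m)" "of_nat m + 1/2"]
      eq[of "- (1/2)" "- of_nat (Suc m)" "- (of_nat (Suc m) + 1/2)"]
    by (simp only: left_diff_distrib distrib_left) simp
  moreover have "two_sinh * (1 + (\<Sum>t=1..Suc m. fps_exp (of_nat t) + fps_exp (- of_nat t))) =
      two_sinh * (1 + (\<Sum>t=1..m. fps_exp (of_nat t) + fps_exp (- of_nat t))) +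
      two_sinh * (fps_exp (of_nat (Suc m)) + fps_exp (- of_nat (Suc m)))"
    by (simp add: algebra_simps del: of_nat_Suc)
  ultimately show ?case
    unfolding Suc by simp
qed simp

lemma Q_fun_fps_product:
  "Abs_fps (\<lambda>k. (-1) ^ k * Q_fun k lam) * Abs_fps (\<lambda>k. Q_fun k lam) =
     fps_X ^ 2 * (\<Sum>c\<in>young_diagram lam. fps_exp (of_nat (hook_length lam c)) +
        fps_exp (- of_nat (hook_length lam c))) + beta_fps ^ 2"
proof -
  obtain n where n: "part lam (Suc n) = 0" using part_eventually_0 by blast
  define m where "m = (\<lambda>i. part lam i + n - i)"
  define S where "S = (\<Sum>i=1..n. fps_exp (of_nat (part lam i) - of_nat i + 1/2 :: rat))"
  define S' where "S' = (\<Sum>i=1..n. fps_exp (- (of_nat (part lam i) - of_nat i + 1/2 :: rat)))"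
  define K where "K = (\<Sum>i=1..n. \<Sum>t=1..m i. fps_exp (of_nat t) + fps_exp (- of_nat t :: rat))"
  define H where "H = (\<Sum>c\<in>young_diagram lam. fps_exp (of_nat (hook_length lam c)) +
        fps_exp (- of_nat (hook_length lam c) :: rat))"
  define R where "R = (\<Sum>i=1..n. \<Sum>k=Suc i..n. fps_exp (of_nat (m i) - of_nat (m k)) +
        fps_exp (of_nat (m k) - of_nat (m i) :: rat))"
  have m: "of_nat (part lam i) - of_nat i = (of_nat (m i) - of_nat n :: rat)" if "i \<in> {1..n}" for i
    using that by (simp add: m_def of_nat_diff)
  have m_le: "m k \<le> m i" if "i \<in> {1..n}" "k \<in> {Suc i..n}" for i k
    using part_antimono[of i k lam] that by (auto simp: m_def)

  have SS': "S * S' = of_nat n + R"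
  proof -
    have "S * S' = (\<Sum>i=1..n. \<Sum>k=1..n. fps_exp (of_nat (m i) - of_nat (m k)))"
      unfolding S_def S'_def sum_product
      by (intro sum.cong refl) (simp add: m flip: fps_exp_add_mult)
    also have "\<dots> = of_nat n + R"
      by (subst sum_square_eq_diagonal_plus) (simp add: R_def)
    finally show ?thesis .
  qed

  have "H + R = K"
  proof -
    have "H = (\<Sum>i=1..n. \<Sum>j=1..part lam i. fps_exp (of_nat (hook_length lam (i, j))) +
        fps_exp (- of_nat (hook_length lam (i, j))))"
      unfolding H_def young_diagram_eq[OF n] by (subst sum.Sigma) (auto simp: split_def)
    moreover have "R = (\<Sum>i=1..n. \<Sum>k=Suc i..n. fps_exp (of_nat (m i - m k)) +
        fps_exp (- of_nat (m i - m k)))"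
      unfolding R_def by (intro sum.cong refl) (simp add: m_le of_nat_diff)
    ultimately have "H + R = (\<Sum>i=1..n. (\<Sum>j=1..part lam i. fps_exp (of_nat (hook_length lam (i, j))) +
          fps_exp (- of_nat (hook_length lam (i, j)))) +
        (\<Sum>k=Suc i..n. fps_exp (of_nat (m i - m k)) + fps_exp (- of_nat (m i - m k))))"
      by (simp only: sum.distrib)
    also have "\<dots> = K"
      unfolding K_def
    proof (rule sum.cong[OF refl])
      fix i assume "i \<in> {1..n}"
      then show "(\<Sum>j=1..part lam i. fps_exp (of_nat (hook_length lam (i, j))) +
          fps_exp (- of_nat (hook_length lam (i, j)))) +
        (\<Sum>k=Suc i..n. fps_exp (of_nat (m i - m k)) + fps_exp (- of_nat (m i - m k))) =
        (\<Sum>t=1..m i. fps_exp (of_nat t) + fps_exp (- of_nat t :: rat))"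
        using sum_row_hook_length[OF n, of i "\<lambda>t. fps_exp (of_nat t) + fps_exp (- of_nat t :: rat)"]
        unfolding m_def by (metis atLeastAtMost_iff)
    qed
    finally show ?thesis .
  qed

  have kernel: "S * fps_exp (of_nat n) - S' * fps_exp (- of_nat n) = two_sinh * (of_nat n + K)"
  proof -
    have "S * fps_exp (of_nat n) - S' * fps_exp (- of_nat n) =
        (\<Sum>i=1..n. fps_exp (of_nat (m i) + 1/2) - fps_exp (- (of_nat (m i) + 1/2)))"
      unfolding S_def S'_def sum_distrib_right sum_subtractf[symmetric]
      by (intro sum.cong refl) (simp add: m flip: fps_exp_add_mult)
    also have "\<dots> = two_sinh * (of_nat n + K)"
      unfolding K_def two_sinh_mult_dirichlet_kernel[symmetric] sum_distrib_left[symmetric] sum.distrib by simp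
    finally show ?thesis .
  qed

  have W: "Abs_fps (\<lambda>k. Q_fun k lam) = fps_X * S + beta_fps * fps_exp (- of_nat n)"
    unfolding S_def by (rule Q_fun_fps[OF n])
  have "Abs_fps (\<lambda>k. (-1) ^ k * Q_fun k lam) = Abs_fps (\<lambda>k. Q_fun k lam) oo (- fps_X)"
    by (simp add: fps_compose_uminus')
  also have "\<dots> = - fps_X * S' + beta_fps * fps_exp (of_nat n)"
    unfolding W S_def S'_def
    by (simp add: fps_compose_add_distrib fps_compose_mult_distrib fps_compose_sum_distrib
          fps_exp_compose_uminus beta_fps_even)
  finally have "Abs_fps (\<lambda>k. (-1) ^ k * Q_fun k lam) * Abs_fps (\<lambda>k. Q_fun k lam) =
      (- fps_X * S' + beta_fps * fps_exp (of_nat n)) * (fps_X * S + beta_fps * fps_exp (- of_nat n))"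
    by (simp only: W)
  also have "\<dots> = - (fps_X ^ 2 * (S * S')) + fps_X * beta_fps * (S * fps_exp (of_nat n) - S' * fps_exp (- of_nat n))
      + beta_fps ^ 2 * (fps_exp (of_nat n) * fps_exp (- of_nat n))"
    by (simp add: algebra_simps power2_eq_square)
  also have "fps_exp (of_nat n) * fps_exp (- of_nat n) = (1 :: rat fps)"
    by (simp flip: fps_exp_add_mult)
  also have "fps_X * beta_fps * (S * fps_exp (of_nat n) - S' * fps_exp (- of_nat n)) =
      fps_X * (beta_fps * two_sinh) * (of_nat n + K)"
    unfolding kernel by (simp only: mult_ac)
  finally show ?thesis
    unfolding beta_fps_mult_two_sinh SS' \<open>H + R = K\<close>[symmetric] H_def[symmetric]
    by (simp add: algebra_simps power2_eq_square)
qed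

lemma Q_fun_convolution:
  assumes "p \<ge> 1"
  shows "(\<Sum>k=0..p+1. (-1) ^ k * Q_fun k lam * Q_fun (p + 1 - k) lam) =
     (if odd p then 2 * of_int (hook_moment p lam) / fact (p - 1) + fps_nth (beta_fps ^ 2) (p + 1) else 0)"
proof -
  have "(\<Sum>k=0..p+1. (-1) ^ k * Q_fun k lam * Q_fun (p + 1 - k) lam) =
      fps_nth (Abs_fps (\<lambda>k. (-1) ^ k * Q_fun k lam) * Abs_fps (\<lambda>k. Q_fun k lam)) (p + 1)"
    by (simp add: fps_mult_nth)
  also have "\<dots> = (\<Sum>c\<in>young_diagram lam. (1 + (-1) ^ (p - 1)) *
      of_nat (hook_length lam c) ^ (p - 1) / fact (p - 1)) + fps_nth (beta_fps ^ 2) (p + 1)"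
    using assms unfolding Q_fun_fps_product
    by (cases p) (simp_all add: fps_X_power_mult_nth fps_sum_nth power_minus[of "of_nat _"] ring_distribs
          add_divide_distrib)
  also have "\<dots> = (if odd p then 2 * of_int (hook_moment p lam) / fact (p - 1) + fps_nth (beta_fps ^ 2) (p + 1) else 0)"
  proof (cases "odd p")
    case True
    then show ?thesis
      by (simp add: hook_moment_def sum_distrib_left sum_divide_distrib)
  next
    case False
    have "(beta_fps ^ 2) oo (- fps_X) = beta_fps ^ 2"
      by (subst fps_compose_power [symmetric]) (simp_all add: beta_fps_even)
    then have "fps_nth ((beta_fps ^ 2) oo (- fps_X)) (p + 1) = fps_nth (beta_fps ^ 2) (p + 1)" by simp
    with False have "fps_nth (beta_fps ^ 2) (p + 1) = 0"
      by (simp add: fps_compose_uminus')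
    with False assms show ?thesis by simp
  qed
  finally show ?thesis .
qed

section \<open>Continuation of the zeta function\<close>

definition zeta_series :: "complex \<Rightarrow> complex" where
  "zeta_series s = (\<Sum>n. 1 / of_nat (Suc n) powr s)"

lemma norm_zeta_term: "norm (1 / of_nat (Suc n) powr s :: complex) = 1 / real (Suc n) powr Re s"
  by (simp add: norm_divide norm_powr_real_powr del: of_nat_Suc)

lemma summable_zeta_real:
  assumes "\<sigma> > 1"
  shows "summable (\<lambda>n. 1 / real (Suc n) powr \<sigma>)"
proof -
  have "summable (\<lambda>n. real n powr (-\<sigma>))"
    using assms by (subst summable_real_powr_iff) simp
  then have "summable (\<lambda>n. real (Suc n) powr (-\<sigma>))"
    by (subst summable_Suc_iff)
  then show ?thesis by (simp add: powr_minus_divide)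
qed

lemma zeta_series_sums:
  assumes "Re s > 1"
  shows "(\<lambda>n. 1 / of_nat (Suc n) powr s) sums zeta_series s"
  unfolding zeta_series_def
  by (rule summable_sums, rule summable_norm_cancel)
     (use summable_zeta_real[OF assms] in \<open>simp only: norm_zeta_term\<close>)

lemma holomorphic_on_suminf:
  fixes f :: "nat \<Rightarrow> complex \<Rightarrow> complex"
  assumes S: "open S" and f: "\<And>n. f n holomorphic_on S"
    and M: "\<And>x. x \<in> S \<Longrightarrow> \<exists>d>0. cball x d \<subseteq> S \<and>
      (\<exists>M. summable M \<and> (\<forall>\<^sub>F n in sequentially. \<forall>y\<in>cball x d. norm (f n y) \<le> M n))"
  shows "(\<lambda>x. \<Sum>n. f n x) holomorphic_on S"
proof (rule holomorphic_uniform_sequence[OF S])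
  show "(\<lambda>x. \<Sum>i<n. f i x) holomorphic_on S" for n
    by (intro holomorphic_intros f)
  show "\<exists>d. 0 < d \<and> cball x d \<subseteq> S \<and>
      uniform_limit (cball x d) (\<lambda>n x. \<Sum>i<n. f i x) (\<lambda>x. \<Sum>n. f n x) sequentially"
    if "x \<in> S" for x
    using M[OF that] Weierstrass_m_test_ev by blast
qed

lemma holomorphic_zeta_series: "zeta_series holomorphic_on {s. Re s > 1}"
  unfolding zeta_series_def
proof (rule holomorphic_on_suminf)
  show "(\<lambda>s. 1 / of_nat (Suc n) powr s) holomorphic_on {s. 1 < Re s}" for n
    by (intro holomorphic_intros) (auto simp del: of_nat_Suc)
next
  fix x :: complex assume x: "x \<in> {s. 1 < Re s}"
  define d where "d = (Re x - 1) / 2"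
  have d: "d > 0" using x by (simp add: d_def)
  have Re: "Re y \<ge> 1 + d" if "y \<in> cball x d" for y
    using that abs_Re_le_cmod[of "x - y"] by (auto simp: dist_norm d_def field_simps)
  have "norm (1 / of_nat (Suc n) powr y :: complex) \<le> 1 / real (Suc n) powr (1 + d)"
    if "y \<in> cball x d" for n y
    unfolding norm_zeta_term using Re[OF that] by (intro divide_left_mono powr_mono) auto
  moreover have "cball x d \<subseteq> {s. 1 < Re s}" using Re d by force
  ultimately show "\<exists>d>0. cball x d \<subseteq> {s. 1 < Re s} \<and> (\<exists>M. summable M \<and>
      (\<forall>\<^sub>F n in sequentially. \<forall>y\<in>cball x d. norm (1 / of_nat (Suc n) powr y :: complex) \<le> M n))"
    using d summable_zeta_real[of "1 + d"]
    by (intro exI[of _ d] conjI exI[of _ "\<lambda>n. 1 / real (Suc n) powr (1 + d)"] always_eventually) auto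
qed (simp add: open_halfspace_Re_gt)

definition pole_free_zeta :: "complex \<Rightarrow> complex" where
  "pole_free_zeta s = (s - 1) * zeta_series s"

definition mid_coeff :: "nat \<Rightarrow> complex \<Rightarrow> complex" where
  "mid_coeff j s = (if even j then ((1 - s) gchoose j) / (of_nat (Suc j) * 2 ^ j) else 0)"

definition mid_bound :: "nat \<Rightarrow> nat \<Rightarrow> real" where
  "mid_bound M j = pochhammer (real M) j / fact j * (1/2) ^ j"

lemma mid_bound_nonneg: "mid_bound M j \<ge> 0"
  by (simp add: mid_bound_def pochhammer_prod prod_nonneg)

lemma summable_mid_bound: "summable (mid_bound M)"
proof -
  have "((- real M) gchoose j) * (- (1/2)) ^ j = mid_bound M j" for j
  proof -
    have "(- 1 :: real) ^ j * (- (1/2)) ^ j = (1/2) ^ j"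
      unfolding power_mult_distrib[symmetric] by simp
    then show ?thesis
      by (simp add: mid_bound_def gbinomial_pochhammer)
  qed
  then show ?thesis
    using gen_binomial_real[of "- (1/2)" "- real M"] by (simp add: sums_iff)
qed

lemma norm_gbinomial_le:
  assumes "norm (a :: complex) \<le> real M"
  shows "norm (a gchoose j) * (1/2) ^ j \<le> mid_bound M j"
proof -
  have "norm (\<Prod>i=0..<j. a - of_nat i) \<le> (\<Prod>i=0..<j. real M + of_nat i)"
    unfolding prod_norm[symmetric]
  proof (rule prod_mono)
    fix i
    have "norm (a - of_nat i) \<le> norm a + norm (of_nat i :: complex)"
      by (rule norm_triangle_ineq4)
    then show "0 \<le> norm (a - of_nat i) \<and> norm (a - of_nat i) \<le> real M + of_nat i"
      using assms by simp
  qed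
  then show ?thesis
    by (simp add: gbinomial_prod_rev mid_bound_def pochhammer_prod norm_divide divide_right_mono mult_right_mono)
qed

lemma norm_mid_coeff_le:
  assumes "norm (1 - s) \<le> real M"
  shows "norm (mid_coeff j s) \<le> mid_bound M j / real (Suc j)"
proof -
  have "norm (((1 - s) gchoose j) / (of_nat (Suc j) * 2 ^ j)) =
      norm ((1 - s) gchoose j) * (1/2) ^ j / real (Suc j)"
    by (simp add: norm_divide norm_mult norm_power power_divide del: of_nat_Suc)
  then show ?thesis
    using norm_gbinomial_le[OF assms, of j] mid_bound_nonneg[of M j]
    by (auto simp: mid_coeff_def intro!: divide_right_mono simp del: of_nat_Suc)
qed

lemma norm_pole_free_zeta_le:
  assumes "Re s \<ge> 2"
  shows "norm (pole_free_zeta s) \<le> norm (s - 1) * (\<Sum>n. 1 / real (Suc n) powr 2)"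
proof -
  have "norm (zeta_series s) \<le> (\<Sum>n. 1 / real (Suc n) powr 2)"
    unfolding zeta_series_def
  proof (rule norm_suminf_le)
    show "norm (1 / of_nat (Suc n) powr s :: complex) \<le> 1 / real (Suc n) powr 2" for n
      unfolding norm_zeta_term using assms by (intro divide_left_mono powr_mono) auto
  qed (rule summable_zeta_real, simp)
  then show ?thesis
    unfolding pole_free_zeta_def norm_mult by (rule mult_left_mono) simp
qed

lemma holomorphic_mid_coeff: "mid_coeff j holomorphic_on S"
  unfolding mid_coeff_def gbinomial_prod_rev
  by (cases "even j") (auto intro!: holomorphic_intros simp del: of_nat_Suc)

lemma holomorphic_mid_sum:
  assumes w: "w holomorphic_on {s. Re s > a}" and eq: "\<And>s. Re s > 1 \<Longrightarrow> w s = pole_free_zeta s"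
  shows "(\<lambda>s. \<Sum>j. mid_coeff (Suc j) s * w (s + of_nat (Suc j))) holomorphic_on {s. Re s > a - 1}"
proof (rule holomorphic_on_suminf)
  show "open {s. Re s > a - 1}" by (simp add: open_halfspace_Re_gt)
  show "(\<lambda>s. mid_coeff (Suc j) s * w (s + of_nat (Suc j))) holomorphic_on {s. Re s > a - 1}" for j
  proof (intro holomorphic_on_mult holomorphic_mid_coeff)
    have "w \<circ> (\<lambda>s. s + of_nat (Suc j)) holomorphic_on {s. Re s > a - 1}"
      by (rule holomorphic_on_compose_gen[OF _ w]) (auto intro!: holomorphic_intros)
    then show "(\<lambda>s. w (s + of_nat (Suc j))) holomorphic_on {s. Re s > a - 1}"
      by (simp add: o_def)
  qed
next
  fix x assume x: "x \<in> {s. Re s > a - 1}"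
  define d where "d = (Re x - (a - 1)) / 2"
  have d: "d > 0" using x by (simp add: d_def)
  define M where "M = nat \<lceil>norm (1 - x) + d\<rceil>"
  define Z where "Z = (\<Sum>n. 1 / real (Suc n) powr 2)"
  have Z: "Z \<ge> 0" unfolding Z_def by (intro suminf_nonneg summable_zeta_real) auto
  have Re: "Re y \<ge> Re x - d" if "y \<in> cball x d" for y
    using that abs_Re_le_cmod[of "x - y"] by (auto simp: dist_norm)
  have norm_y: "norm (1 - y) \<le> real M" if "y \<in> cball x d" for y
  proof -
    have "norm (1 - y) \<le> norm (1 - x) + norm (x - y)"
      using norm_triangle_ineq[of "1 - x" "x - y"] by simp
    also have "\<dots> \<le> real M" using that unfolding M_def by (simp add: dist_norm) linarith
    finally show ?thesis .
  qed
  have "\<forall>\<^sub>F j in sequentially. \<forall>y\<in>cball x d.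
      norm (mid_coeff (Suc j) y * w (y + of_nat (Suc j))) \<le> mid_bound M (Suc j) * (real (Suc M) * Z)"
    using eventually_ge_at_top[of "nat \<lceil>2 - (Re x - d)\<rceil>"]
  proof eventually_elim
    case (elim j)
    show ?case
    proof
      fix y assume y: "y \<in> cball x d"
      have Re2: "Re (y + of_nat (Suc j)) \<ge> 2" using elim Re[OF y] by simp
      have "norm (w (y + of_nat (Suc j))) \<le> norm (y + of_nat (Suc j) - 1) * Z"
        using norm_pole_free_zeta_le[OF Re2] eq[of "y + of_nat (Suc j)"] Re2 by (simp add: Z_def)
      also have "norm (y + of_nat (Suc j) - 1) \<le> norm (1 - y) + real (Suc j)"
        using norm_triangle_ineq4[of "of_nat (Suc j)" "1 - y"]
        by (simp add: algebra_simps del: of_nat_Suc)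
      also have "\<dots> \<le> real (Suc M) * real (Suc j)"
        using norm_y[OF y] by (simp add: algebra_simps add_increasing2)
      finally have "norm (w (y + of_nat (Suc j))) \<le> real (Suc M) * real (Suc j) * Z"
        using Z by (simp add: mult_right_mono)
      moreover have "norm (mid_coeff (Suc j) y) \<le> mid_bound M (Suc j) / real (Suc (Suc j))"
        by (rule norm_mid_coeff_le[OF norm_y[OF y]])
      ultimately have "norm (mid_coeff (Suc j) y * w (y + of_nat (Suc j))) \<le>
          (mid_bound M (Suc j) / real (Suc (Suc j))) * (real (Suc M) * real (Suc j) * Z)"
        unfolding norm_mult by (intro mult_mono) (auto simp: mid_bound_nonneg)
      also have "\<dots> = (mid_bound M (Suc j) * (real (Suc M) * Z)) * (real (Suc j) / real (Suc (Suc j)))"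
        by (simp del: of_nat_Suc)
      also have "\<dots> \<le> (mid_bound M (Suc j) * (real (Suc M) * Z)) * 1"
        using Z by (intro mult_left_mono) (auto simp: mid_bound_nonneg)
      finally show "norm (mid_coeff (Suc j) y * w (y + of_nat (Suc j))) \<le>
          mid_bound M (Suc j) * (real (Suc M) * Z)" by simp
    qed
  qed
  moreover have "summable (\<lambda>j. mid_bound M (Suc j) * (real (Suc M) * Z))"
    by (intro summable_mult2) (use summable_mid_bound[of M] in \<open>simp add: summable_Suc_iff\<close>)
  moreover have "cball x d \<subseteq> {s. Re s > a - 1}"
    using Re d by (force simp: d_def field_simps)
  ultimately show "\<exists>d>0. cball x d \<subseteq> {s. Re s > a - 1} \<and> (\<exists>M. summable M \<and>
     (\<forall>\<^sub>F j in sequentially. \<forall>y\<in>cball x d. norm (mid_coeff (Suc j) y * w (y + of_nat (Suc j))) \<le> M j))"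
    using d by (intro exI[of _ d] conjI exI[of _ "\<lambda>j. mid_bound M (Suc j) * (real (Suc M) * Z)"])
qed

text \<open>Expand \<open>(N + 1/2)\<^bsup>1-s\<^esup> - (N - 1/2)\<^bsup>1-s\<^esup>\<close> by the binomial series and sum over \<open>N \<ge> 1\<close>:
  the left-hand side telescopes, the right-hand side becomes a series in \<open>\<zeta>(s + j)\<close>.\<close>

lemma pole_free_zeta_functional_eq:
  assumes s: "Re s > 1"
  shows "pole_free_zeta s = (1/2) powr (1 - s) - (\<Sum>j. mid_coeff (Suc j) s * pole_free_zeta (s + of_nat (Suc j)))"
proof -
  define a where "a = 1 - s"
  define C where "C = (\<lambda>j. if even j then (a gchoose Suc j) * (1/2) ^ j else 0)"
  define F where "F = (\<lambda>(n, j). C j * (1 / of_nat (Suc n) powr (s + of_nat j)))"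
  define u where "u = (\<lambda>n. (of_real (real n + 3/2) powr a - of_real (real n + 1/2) powr a :: complex))"

  obtain M :: nat where M: "norm a \<le> real M" using real_arch_simple by blast
  have C_le: "norm (C j) \<le> 2 * mid_bound M (Suc j)" for j
    using norm_gbinomial_le[OF M, of "Suc j"] mid_bound_nonneg[of M "Suc j"]
    by (auto simp: C_def norm_mult norm_power norm_divide)
  have summable_C: "summable (\<lambda>j. norm (C j))"
    by (rule summable_comparison_test'[of "\<lambda>j. 2 * mid_bound M (Suc j)" 0])
       (use C_le summable_mid_bound[of M] in \<open>auto simp: summable_Suc_iff intro!: summable_mult\<close>)

  have norm_F: "norm (F (n, j)) \<le> norm (C j) * (1 / real (Suc n) powr Re s)" for n j
  proof -
    have "1 / real (Suc n) powr Re (s + of_nat j) \<le> 1 / real (Suc n) powr Re s"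
      by (intro divide_left_mono powr_mono) auto
    then show ?thesis
      unfolding F_def prod.case norm_mult norm_zeta_term by (rule mult_left_mono) simp
  qed

  have row: "((\<lambda>j. F (n, j)) has_sum u n) UNIV" for n
  proof (rule norm_summable_imp_has_sum)
    show "summable (\<lambda>j. norm (F (n, j)))"
      by (rule summable_comparison_test'[of "\<lambda>j. norm (C j) * (1 / real (Suc n) powr Re s)" 0])
         (use norm_F[of n] summable_mult2[OF summable_C, of "1 / real (Suc n) powr Re s"] in simp_all)
    define t where "t = (\<lambda>j. (a gchoose j) * of_real (1/2) ^ j * of_real (real (Suc n)) powr (a - of_nat j)
      - (a gchoose j) * of_real (- (1/2)) ^ j * of_real (real (Suc n)) powr (a - of_nat j))"
    have "t sums (of_real (1/2 + real (Suc n)) powr a - of_real (- (1/2) + real (Suc n)) powr a)"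
      unfolding t_def by (intro sums_diff gen_binomial_complex') auto
    also have "of_real (1/2 + real (Suc n)) powr a - of_real (- (1/2) + real (Suc n)) powr a = u n"
      by (simp add: u_def algebra_simps)
    finally have "t sums u n" .
    then have "(\<lambda>j. t (Suc j)) sums u n"
      by (subst sums_Suc_iff) (simp add: t_def)
    moreover have "t (Suc j) = F (n, j)" for j
    proof -
      have "a - of_nat (Suc j) = - (s + of_nat j)" by (simp add: a_def)
      then have "of_nat (Suc n) powr (a - of_nat (Suc j)) = 1 / of_nat (Suc n) powr (s + of_nat j)"
        by (simp only: powr_minus_divide)
      then show ?thesis
        unfolding t_def F_def C_def
        by (cases "even j") (simp_all del: of_nat_Suc)
    qed
    ultimately show "(\<lambda>j. F (n, j)) sums u n" by simp
  qed

  have col: "((\<lambda>n. F (n, j)) has_sum C j * zeta_series (s + of_nat j)) UNIV" for j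
    unfolding F_def prod.case
  proof (rule has_sum_cmult_right, rule norm_summable_imp_has_sum)
    show "summable (\<lambda>n. norm (1 / of_nat (Suc n) powr (s + of_nat j) :: complex))"
      unfolding norm_zeta_term using s by (intro summable_zeta_real) simp
    show "(\<lambda>n. 1 / of_nat (Suc n) powr (s + of_nat j)) sums zeta_series (s + of_nat j)"
      using s by (intro zeta_series_sums) simp
  qed

  define K where "K = (\<Sum>j. norm (C j))"
  have "(\<lambda>x. norm (F x)) summable_on (UNIV \<times> UNIV)"
  proof (rule Infinite_Sum.abs_summable_on_comparison_test')
    show "norm (F x) \<le> (\<lambda>(n, j). norm (C j) * (1 / real (Suc n) powr Re s)) x" for x
      using norm_F by (cases x) auto
    show "(\<lambda>(n, j). norm (C j) * (1 / real (Suc n) powr Re s)) summable_on UNIV \<times> UNIV"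
    proof (rule summable_on_SigmaI)
      show "((\<lambda>j. (\<lambda>(n, j). norm (C j) * (1 / real (Suc n) powr Re s)) (n, j)) has_sum
          K * (1 / real (Suc n) powr Re s)) UNIV" for n
        unfolding prod.case K_def using summable_C
        by (intro has_sum_cmult_left norm_summable_imp_has_sum) (auto intro: summable_sums)
      show "(\<lambda>n. K * (1 / real (Suc n) powr Re s)) summable_on UNIV"
        using summable_zeta_real[OF s]
        by (intro summable_on_cmult_right norm_summable_imp_summable_on) simp
    qed auto
  qed
  then obtain T where T: "(F has_sum T) (UNIV \<times> UNIV)"
    using Infinite_Sum.abs_summable_summable summable_on_def by blast
  then have T': "((\<lambda>(j, n). F (n, j)) has_sum T) (UNIV \<times> UNIV)"
    by (subst has_sum_swap) simp

  have "u sums T"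
    using has_sum_SigmaD[OF T row] by (rule has_sum_imp_sums)
  moreover have "u sums (0 - of_real (real 0 + 1/2) powr a)"
  proof -
    have "filterlim (\<lambda>n. real n + 1/2) at_top sequentially"
      using filterlim_tendsto_add_at_top[OF tendsto_const filterlim_real_sequentially, of "1/2"]
      by (simp add: add.commute)
    from tendsto_neg_powr_complex_of_real[OF this, of a] s
    have "(\<lambda>n. of_real (real n + 1/2) powr a) \<longlonglongrightarrow> 0" by (simp add: a_def)
    from telescope_sums[OF this] show ?thesis
      by (simp add: u_def algebra_simps)
  qed
  ultimately have T_eq: "T = - ((1/2) powr a)"
    using sums_unique2 by fastforce

  have "((\<lambda>j. C j * zeta_series (s + of_nat j)) has_sum T) UNIV"
    using has_sum_SigmaD[OF T', of "\<lambda>j. C j * zeta_series (s + of_nat j)"] col by simp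
  then have "(\<lambda>j. C j * zeta_series (s + of_nat j)) sums T"
    by (rule has_sum_imp_sums)
  moreover have "C j * zeta_series (s + of_nat j) = - (mid_coeff j s * pole_free_zeta (s + of_nat j))" for j
  proof (cases "even j")
    case True
    have "(a - of_nat j) * (a gchoose j) = of_nat (Suc j) * (a gchoose (Suc j))"
      using gbinomial_mult_1[of a j] by (simp add: algebra_simps)
    then have "a gchoose (Suc j) = (a - of_nat j) * (a gchoose j) / of_nat (Suc j)"
      by (simp add: field_simps del: of_nat_Suc)
    moreover have "s + of_nat j - 1 = - (a - of_nat j)" by (simp add: a_def)
    ultimately show ?thesis
      using True unfolding C_def mid_coeff_def pole_free_zeta_def a_def[symmetric]
      by (simp only: if_True mult_minus_left mult_minus_right) (simp add: power_divide del: of_nat_Suc)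
  qed (simp add: C_def mid_coeff_def)
  ultimately have "(\<lambda>j. mid_coeff j s * pole_free_zeta (s + of_nat j)) sums (1/2) powr a"
    using sums_minus unfolding T_eq by fastforce
  then have "(\<lambda>j. mid_coeff (Suc j) s * pole_free_zeta (s + of_nat (Suc j))) sums
      ((1/2) powr a - mid_coeff 0 s * pole_free_zeta (s + of_nat 0))"
    by (subst sums_Suc_iff) simp
  then show ?thesis
    by (simp add: sums_iff mid_coeff_def a_def)
qed

lemma pole_free_zeta_continuation_halfplane:
  "\<exists>w. w holomorphic_on {s. Re s > 1 - real n} \<and> (\<forall>s. Re s > 1 \<longrightarrow> w s = pole_free_zeta s)"
proof (induction n)
  case 0
  have "pole_free_zeta holomorphic_on {s. Re s > 1}"
    unfolding pole_free_zeta_def by (intro holomorphic_intros holomorphic_zeta_series)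
  then show ?case by auto
next
  case (Suc n)
  then obtain w where w: "w holomorphic_on {s. Re s > 1 - real n}"
    "\<And>s. Re s > 1 \<Longrightarrow> w s = pole_free_zeta s" by blast
  define v where "v = (\<lambda>s. (1/2) powr (1 - s) - (\<Sum>j. mid_coeff (Suc j) s * w (s + of_nat (Suc j))))"
  have "v holomorphic_on {s. Re s > 1 - real n - 1}"
    unfolding v_def by (intro holomorphic_on_diff holomorphic_mid_sum w) (auto intro!: holomorphic_intros)
  moreover have "v s = pole_free_zeta s" if "Re s > 1" for s
    using that w(2) by (simp add: v_def pole_free_zeta_functional_eq[OF that])
  ultimately show ?case by (intro exI[of _ v]) (simp add: algebra_simps)
qed

lemma halfplane_identity:
  assumes "f holomorphic_on {s. Re s > a}" "g holomorphic_on {s. Re s > a}"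
    and "\<And>s. Re s > 1 \<Longrightarrow> f s = g s" and "Re z > a"
  shows "f z = g z"
proof (rule analytic_continuation_open[of "{s. Re s > max a 1}" "{s. Re s > a}" f g])
  show "open {s. Re s > max a 1}" "open {s. Re s > a}"
    by (rule open_halfspace_Re_gt)+
  show "{s. Re s > max a 1} \<noteq> {}"
    by (auto intro!: exI[of _ "of_real (max a 1 + 1)"])
  show "connected {s. Re s > a}"
    by (intro convex_connected convex_halfspace_Re_gt)
qed (use assms in auto)

lemma pole_free_zeta_continuation:
  "\<exists>w. w holomorphic_on UNIV \<and> (\<forall>s. Re s > 1 \<longrightarrow> w s = pole_free_zeta s)"
proof -
  obtain W where hol: "\<And>n. W n holomorphic_on {s. Re s > 1 - real n}"
    and eq: "\<And>n s. Re s > 1 \<Longrightarrow> W n s = pole_free_zeta s"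
    using pole_free_zeta_continuation_halfplane by metis
  have agree: "W m s = W n s" if "m \<le> n" "Re s > 1 - real m" for m n s
    using halfplane_identity[of "W m" "1 - real m" "W n" s] hol[of m] eq that
      holomorphic_on_subset[OF hol[of n], of "{s. Re s > 1 - real m}"] by fastforce
  define N where "N = (\<lambda>s. nat \<lceil>1 - Re s\<rceil> + 1)"
  define w where "w = (\<lambda>s. W (N s) s)"
  have N: "Re s > 1 - real (N s)" for s
    unfolding N_def by simp linarith
  have w_eq: "w s = W n s" if "Re s > 1 - real n" for n s
    unfolding w_def using agree[OF _ that, of "N s"] agree[OF _ N[of s], of n] nat_le_linear[of n "N s"] by metis
  have "w holomorphic_on (\<Union>n. {s. Re s > 1 - real n})"
  proof (rule holomorphic_on_UN_open)
    show "w holomorphic_on {s. Re s > 1 - real n}" for n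
      using hol[of n] by (rule holomorphic_transform) (simp add: w_eq)
  qed (simp add: open_halfspace_Re_gt)
  moreover have "(\<Union>n. {s. Re s > 1 - real n}) = UNIV" using N by blast
  moreover have "w s = pole_free_zeta s" if "Re s > 1" for s
    unfolding w_def by (rule eq[OF that])
  ultimately show ?thesis by metis
qed

lemma riemann_zeta_eq:
  assumes w: "w holomorphic_on UNIV" "\<And>s. Re s > 1 \<Longrightarrow> w s = pole_free_zeta s" and s: "s \<noteq> 1"
  shows "riemann_zeta s = w s / (s - 1)"
proof -
  define f where "f = (\<lambda>s. if s = 1 then 0 else w s / (s - 1))"
  have "riemann_zeta = f"
    unfolding riemann_zeta_def
  proof (rule the_equality)
    have "(\<lambda>s. w s / (s - 1)) holomorphic_on (- {1})"
      by (intro holomorphic_intros holomorphic_on_subset[OF w(1)]) auto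
    then have "f holomorphic_on (- {1})"
      by (rule holomorphic_transform) (auto simp: f_def)
    moreover have "f s = (\<Sum>n. 1 / of_nat (Suc n) powr s)" if "Re s > 1" for s
      using that w(2)[OF that] by (auto simp: f_def pole_free_zeta_def zeta_series_def)
    ultimately show "f holomorphic_on (- {1}) \<and>
        (\<forall>s. Re s > 1 \<longrightarrow> f s = (\<Sum>n. 1 / of_nat (Suc n) powr s)) \<and> f 1 = 0"
      by (auto simp: f_def)
  next
    fix g assume g: "g holomorphic_on (- {1}) \<and>
        (\<forall>s. Re s > 1 \<longrightarrow> g s = (\<Sum>n. 1 / of_nat (Suc n) powr s)) \<and> g 1 = 0"
    show "g = f"
    proof
      fix z show "g z = f z"
      proof (cases "z = 1")
        case False
        have "(\<lambda>s. w s / (s - 1)) holomorphic_on (- {1})"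
          by (intro holomorphic_intros holomorphic_on_subset[OF w(1)]) auto
        moreover have "g s = w s / (s - 1)" if "Re s > 1" for s
          using g w(2)[OF that] that by (auto simp: pole_free_zeta_def zeta_series_def)
        moreover have "2 \<in> {s. Re s > 1}" by simp
        then have "{s. Re s > 1} \<noteq> {}" by blast
        moreover have "connected (- {1 :: complex})"
          by (rule connected_punctured_universe) simp
        moreover have "open (- {1 :: complex})" "{s. Re s > 1} \<subseteq> - {1}"
          by (auto simp: open_Compl)
        ultimately have "g z = w z / (z - 1)"
          using g False open_halfspace_Re_gt[of 1]
          by (intro analytic_continuation_open[of "{s. Re s > 1}" "- {1}" g "\<lambda>s. w s / (s - 1)" z])
             simp_all
        with False show ?thesis by (simp add: f_def)
      qed (use g in \<open>simp add: f_def\<close>)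
    qed
  qed
  then have "riemann_zeta s = f s" by (rule fun_cong)
  with s show ?thesis by (simp add: f_def)
qed

section \<open>Zeta values at negative integers\<close>

text \<open>The exponential generating function of the Bernoulli numbers, with \<open>B\<^sub>1 = 1/2\<close>.\<close>

definition bernoulli_fps :: "rat fps" where
  "bernoulli_fps = beta_fps * fps_exp (1/2)"

lemma bernoulli_fps_recurrence:
  "(\<Sum>j\<le>m. (if even j then of_nat (m choose j) / (of_nat (Suc j) * 2 ^ j) else 0) *
      (fact (m - j) * fps_nth bernoulli_fps (m - j))) = (1/2) ^ m"
proof -
  define G :: "rat fps" where "G = Abs_fps (\<lambda>j. if even j then 1 / (2 ^ j * fact (Suc j)) else 0)"
  have "fps_X * G = two_sinh"
  proof (rule fps_ext)
    fix n show "fps_nth (fps_X * G) n = fps_nth two_sinh n"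
      by (cases n) (auto simp: G_def power_divide field_simps simp del: fact_Suc)
  qed
  then have "fps_X * (G * bernoulli_fps) = fps_X * fps_exp (1/2)"
    unfolding bernoulli_fps_def by (simp flip: beta_fps_mult_two_sinh add: mult_ac)
  then have "G * bernoulli_fps = fps_exp (1/2)" by simp
  then have "fps_nth (G * bernoulli_fps) m = fps_nth (fps_exp (1/2)) m" by simp
  then have "(\<Sum>j\<le>m. fps_nth G j * fps_nth bernoulli_fps (m - j)) = (1/2) ^ m / fact m"
    by (simp add: fps_mult_nth atLeast0AtMost)
  then have "(1/2) ^ m = (\<Sum>j\<le>m. fact m * (fps_nth G j * fps_nth bernoulli_fps (m - j)))"
    by (simp flip: sum_distrib_left)
  also have "\<dots> = (\<Sum>j\<le>m. (if even j then of_nat (m choose j) / (of_nat (Suc j) * 2 ^ j) else 0) *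
      (fact (m - j) * fps_nth bernoulli_fps (m - j)))"
    by (intro sum.cong refl) (auto simp: G_def binomial_fact divide_simps simp del: of_nat_Suc)
  finally show ?thesis ..
qed

lemma zeta_continuation_at_nonpos:
  assumes w: "w holomorphic_on UNIV" "\<And>s. Re s > 1 \<Longrightarrow> w s = pole_free_zeta s"
  shows "w (1 - of_nat m) = of_rat (fact m * fps_nth bernoulli_fps m)"
proof (induction m rule: less_induct)
  case (less m)
  define b where "b = (\<lambda>j. if even j then of_nat (m choose j) / (of_nat (Suc j) * 2 ^ j) else (0 :: rat))"
  have b: "(\<Sum>j\<le>m. b j * (fact (m - j) * fps_nth bernoulli_fps (m - j))) = (1/2) ^ m" "b 0 = 1"
    unfolding b_def by (rule bernoulli_fps_recurrence) simp
  define f where "f = (\<lambda>s. (1/2) powr (1 - s) - (\<Sum>j. mid_coeff (Suc j) s * w (s + of_nat (Suc j))))"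
  have "w (1 - of_nat m) = f (1 - of_nat m)"
  proof (rule halfplane_identity[of w "- real m" f])
    have "f holomorphic_on {s. Re s > (1 - real m) - 1}"
      unfolding f_def using w
      by (intro holomorphic_on_diff holomorphic_mid_sum) (auto intro!: holomorphic_intros intro: holomorphic_on_subset)
    then show "f holomorphic_on {s. Re s > - real m}" by simp
    show "w s = f s" if "Re s > 1" for s
      using that w(2) by (simp add: f_def pole_free_zeta_functional_eq[OF that])
  qed (use w(1) in \<open>auto intro: holomorphic_on_subset\<close>)
  also have "\<dots> = (1/2) ^ m - (\<Sum>j. mid_coeff (Suc j) (1 - of_nat m) * w (1 - of_nat m + of_nat (Suc j)))"
    by (simp add: f_def powr_nat del: of_nat_Suc)
  also have "(\<Sum>j. mid_coeff (Suc j) (1 - of_nat m) * w (1 - of_nat m + of_nat (Suc j))) =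
      (\<Sum>j<m. mid_coeff (Suc j) (1 - of_nat m) * w (1 - of_nat m + of_nat (Suc j)))"
  proof (rule suminf_finite)
    fix j assume "j \<notin> {..<m}"
    then have "(of_nat m :: complex) gchoose Suc j = 0"
      by (simp flip: binomial_gbinomial)
    then show "mid_coeff (Suc j) (1 - of_nat m) * w (1 - of_nat m + of_nat (Suc j)) = 0"
      by (simp add: mid_coeff_def)
  qed simp
  also have "\<dots> = (\<Sum>j<m. of_rat (b (Suc j) * (fact (m - Suc j) * fps_nth bernoulli_fps (m - Suc j))))"
  proof (rule sum.cong[OF refl])
    fix j assume j: "j \<in> {..<m}"
    then have "1 - of_nat m + of_nat (Suc j) = (1 - of_nat (m - Suc j) :: complex)"
      by (simp add: of_nat_diff)
    moreover have "mid_coeff (Suc j) (1 - of_nat m) = of_rat (b (Suc j))"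
      by (simp add: mid_coeff_def b_def of_rat_divide of_rat_mult of_rat_power
            del: of_nat_Suc flip: binomial_gbinomial)
    ultimately show "mid_coeff (Suc j) (1 - of_nat m) * w (1 - of_nat m + of_nat (Suc j)) =
        of_rat (b (Suc j) * (fact (m - Suc j) * fps_nth bernoulli_fps (m - Suc j)))"
      using less[of "m - Suc j"] j by (simp only: of_rat_mult) simp
  qed
  also have "(1/2) ^ m - \<dots> = of_rat ((1/2) ^ m -
      (\<Sum>j<m. b (Suc j) * (fact (m - Suc j) * fps_nth bernoulli_fps (m - Suc j))))"
    by (simp add: of_rat_diff of_rat_sum of_rat_power of_rat_divide)
  also have "(1/2) ^ m - (\<Sum>j<m. b (Suc j) * (fact (m - Suc j) * fps_nth bernoulli_fps (m - Suc j))) =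
      fact m * fps_nth bernoulli_fps m"
    unfolding b(1)[symmetric] by (simp add: sum.atMost_shift b(2))
  finally show ?case .
qed

lemma beta_fps_square: "beta_fps ^ 2 = bernoulli_fps - fps_X * fps_deriv bernoulli_fps"
proof -
  define e where "e = (fps_exp (1/2) :: rat fps)"
  define e' where "e' = (fps_exp (- (1/2)) :: rat fps)"
  define h where "h = (fps_const (1/2) :: rat fps)"
  define \<beta>' where "\<beta>' = fps_deriv beta_fps"
  have ee': "e * e' = 1" by (simp add: e_def e'_def flip: fps_exp_add_mult)
  have h: "h + h = 1" by (simp add: h_def flip: fps_const_add)
  have X: "beta_fps * (e - e') = fps_X"
    using beta_fps_mult_two_sinh by (simp add: e_def e'_def)
  have "fps_deriv (beta_fps * (e - e')) = 1" by (simp add: X)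
  then have "\<beta>' * (e - e') + beta_fps * (h * e + h * e') = 1"
    by (simp add: e_def e'_def h_def \<beta>'_def algebra_simps flip: fps_const_neg)
  then have D: "\<beta>' * (e - e') = 1 - beta_fps * (h * e + h * e')"
    by (simp only: eq_diff_eq)
  have "(bernoulli_fps - fps_X * fps_deriv bernoulli_fps) * (e - e') =
      (beta_fps * e - fps_X * (\<beta>' * e + beta_fps * (h * e))) * (e - e')"
    by (simp add: bernoulli_fps_def \<beta>'_def h_def e_def algebra_simps)
  also have "\<dots> = e * (beta_fps * (e - e') - fps_X * (\<beta>' * (e - e')) - h * fps_X * (beta_fps * (e - e')))"
    by (simp add: algebra_simps)
  also have "\<dots> = e * (fps_X - fps_X * (1 - beta_fps * (h * e + h * e')) - h * fps_X * fps_X)"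
    unfolding X D ..
  also have "\<dots> = e * (fps_X - fps_X * (1 - beta_fps * (h * e + h * e')) - h * fps_X * (beta_fps * (e - e')))"
    unfolding X ..
  also have "\<dots> = (h + h) * (e * e') * fps_X * beta_fps"
    by (simp add: algebra_simps)
  also have "\<dots> = beta_fps * (beta_fps * (e - e'))"
    unfolding h ee' X by simp
  also have "\<dots> = beta_fps ^ 2 * (e - e')"
    by (simp only: power2_eq_square mult.assoc)
  finally show ?thesis
    using two_sinh_nz by (simp add: e_def e'_def)
qed

lemma riemann_zeta_neg:
  assumes "p \<ge> 1"
  shows "riemann_zeta (- of_nat p) = of_rat (fact (p - 1) * fps_nth (beta_fps ^ 2) (p + 1))"
proof -
  obtain w where w: "w holomorphic_on UNIV" "\<And>s. Re s > 1 \<Longrightarrow> w s = pole_free_zeta s"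
    using pole_free_zeta_continuation by blast
  obtain q where q: "p = Suc q" using assms by (cases p) auto
  have "- of_nat p \<noteq> (1 :: complex)"
  proof
    assume "- of_nat p = (1 :: complex)"
    then have "Re (- of_nat p) = Re 1" by (simp only:)
    then show False by simp
  qed
  then have "riemann_zeta (- of_nat p) = w (- of_nat p) / (- of_nat p - 1)"
    using riemann_zeta_eq[of w] w by blast
  also have "w (- of_nat p) = w (1 - of_nat (p + 1))" by simp
  also have "\<dots> = of_rat (fact (p + 1) * fps_nth bernoulli_fps (p + 1))"
    using zeta_continuation_at_nonpos[of w] w by blast
  also have "(- of_nat p - 1 :: complex) = of_rat (- of_nat (p + 1))"
    by (simp add: of_rat_minus of_rat_diff)
  also have "of_rat (fact (p + 1) * fps_nth bernoulli_fps (p + 1)) / of_rat (- of_nat (p + 1)) =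
      (of_rat (fact (p + 1) * fps_nth bernoulli_fps (p + 1) / (- of_nat (p + 1))) :: complex)"
    by (simp only: of_rat_divide)
  also have "fact (p + 1) * fps_nth bernoulli_fps (p + 1) / (- of_nat (p + 1)) =
      fact (p - 1) * fps_nth (beta_fps ^ 2) (p + 1)"
    unfolding beta_fps_square q by (simp add: field_simps)
  finally show ?thesis .
qed

lemma of_rat_fact: "of_rat (fact n) = (fact n :: 'a :: field_char_0)"
  by (metis of_nat_fact of_rat_of_nat_eq)

lemma hook_moment_reg_eq:
  assumes "p \<ge> 1"
  shows "hook_moment_reg p lam = of_rat (fact (p - 1) *
    (1/2 * (\<Sum>k=0..p+1. (-1) ^ k * Q_fun k lam * Q_fun (p + 1 - k) lam)))"
proof (cases "odd p")
  case True
  define b where "b = fps_nth (beta_fps ^ 2) (p + 1)"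
  have "hook_moment_reg p lam = of_rat (of_int (hook_moment p lam) + fact (p - 1) * b / 2)"
    using True unfolding hook_moment_reg_def riemann_zeta_neg[OF assms] b_def[symmetric]
    by (simp add: of_rat_add of_rat_divide)
  also have "of_int (hook_moment p lam) + fact (p - 1) * b / 2 =
      fact (p - 1) * (1/2 * (2 * of_int (hook_moment p lam) / fact (p - 1) + b))"
    by (simp add: field_simps)
  finally show ?thesis
    using True unfolding Q_fun_convolution[OF assms] b_def by simp
next
  case False
  then show ?thesis
    unfolding Q_fun_convolution[OF assms] hook_moment_reg_def by simp
qed

theorem theorem13p5:
  fixes p :: nat
  assumes "p \<ge> 1"
  shows "(odd p \<longrightarrow> (\<lambda>lam. of_int (hook_moment p lam)) \<in> shifted_symmetric) \<and>
    (\<exists>F \<in> homogeneous_weight (p + 1). \<forall>lam. hook_moment_reg p lam = of_rat (F lam)) \<and>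
    (\<forall>lam. hook_moment_reg p lam / fact (p - 1) =
       of_rat (1/2 * (\<Sum>k=0..p+1. (-1) ^ k * Q_fun k lam * Q_fun (p + 1 - k) lam)))"
proof (intro conjI impI allI)
  define F where "F = (\<lambda>lam. fact (p - 1) *
    (1/2 * (\<Sum>k=0..p+1. (-1) ^ k * Q_fun k lam * Q_fun (p + 1 - k) lam)))"
  have F: "F \<in> shifted_symmetric"
    unfolding F_def
    by (intro shifted_symmetric_mult shifted_symmetric_sum shifted_symmetric_const shifted_symmetric_Q_fun)
  have "F \<in> homogeneous_weight (p + 1)"
  proof -
    define S where "S = (\<lambda>k. [k, p + 1 - k]) ` {0..p+1}"
    define c :: "nat list \<Rightarrow> rat" where "c = (\<lambda>ks. fact (p - 1) * (1/2 * (-1) ^ hd ks))"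
    have "inj_on (\<lambda>k. [k, p + 1 - k]) {0..p+1}" by (rule inj_onI) simp
    then have "F lam = (\<Sum>ks\<in>S. c ks * (\<Prod>k\<leftarrow>ks. Q_fun k lam))" for lam
      by (simp add: S_def c_def F_def sum.reindex sum_distrib_left mult.assoc del: sum.cl_ivl_Suc)
    moreover have "finite S" "\<forall>ks\<in>S. sum_list ks = p + 1"
      by (auto simp: S_def)
    ultimately show ?thesis
      unfolding homogeneous_weight_def using F by blast
  qed
  then show "\<exists>F \<in> homogeneous_weight (p + 1). \<forall>lam. hook_moment_reg p lam = of_rat (F lam)"
  proof (rule bexI[rotated])
    show "\<forall>lam. hook_moment_reg p lam = of_rat (F lam)"
      unfolding F_def using hook_moment_reg_eq[OF assms] by blast
  qed
  show "hook_moment_reg p lam / fact (p - 1) =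
       of_rat (1/2 * (\<Sum>k=0..p+1. (-1) ^ k * Q_fun k lam * Q_fun (p + 1 - k) lam))" for lam
    unfolding hook_moment_reg_eq[OF assms] of_rat_mult[of "fact (p - 1)"] of_rat_fact
    by (rule nonzero_mult_div_cancel_left) (rule fact_nonzero)
  assume "odd p"
  then have "(\<lambda>lam. of_int (hook_moment p lam)) =
      (\<lambda>lam. F lam + (- (fact (p - 1) * fps_nth (beta_fps ^ 2) (p + 1) / 2)))"
    unfolding F_def Q_fun_convolution[OF assms] by (simp add: field_simps)
  also have "\<dots> \<in> shifted_symmetric"
    by (intro shifted_symmetric_add shifted_symmetric_const F)
  finally show "(\<lambda>lam. of_int (hook_moment p lam)) \<in> shifted_symmetric" .
qed

end
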